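(* Let $f=x^2+a_1x+a_0\in\mathbb{R}[x]$ have no real roots, with non-real roots $re^{\pm i\theta}$, $r>0$, $0<\theta<\pi$, and let $s=\left\lceil \frac{\pi}{\theta}\right\rceil -2$. Let $c_R,c_M\in\mathbb{R}^{s+1}$ be the $c$-vectors of $g_R$ and $g_M^{*}$ as defined in the context. Then $c_R\leq c_M$ entrywise in $\mathbb{R}^{s+1}$; more precisely, $c_{R,s-1}\leq c_{M,s-1}$ (when $s\ge 1$) and all other entries of $c_R$ and $c_M$ are equal.
   Context: Vectors in $\mathbb{R}^{s+1}$ are row vectors with entries indexed by $0,\ldots,s$. Let $R_s\in\mathbb{R}^{(s+1)\times(s+1)}$ (indices $0,\ldots,s$) be the lower triangular matrix with $(R_s)_{k,k}=1$, $(R_s)_{k+1,k}=a_1$, $(R_s)_{k+2,k}=a_0$, and all other entries $0$. For a polynomial $g=\sum_{i=0}^s b_ix^i$, its $c$-vector is $c=bR_s$ with $b=[b_0\ \cdots\ b_s]$. The polynomial $g_R$ is the determinant $g_R=\det M$, where $M=(M_{k,l})_{0\le k,l\le s}$ is the $(s+1)\times(s+1)$ matrix over $\mathbb{R}[x]$ whose last column is $M_{k,s}=x^{k}$ and whose other columns coincide with columns $0,\ldots,s-1$ of $R_s$. Its $c$-vector is $c_R=[0\ \cdots\ 0\ 1]$. Meissner's monic multiplier is $$g_{M}^{*}=\sum_{i=0}^{s}\frac{r^{s-i}\sin\big((i+1)\theta\big)}{\sin\big((s+1)\theta\big)}\,x^{i},$$ and $c_M$ denotes its $c$-vector. *)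

theory Defs
  imports Complex_Main "Jordan_Normal_Form.Determinant"
begin

definition R_mat :: "real \<Rightarrow> real \<Rightarrow> nat \<Rightarrow> real mat" where
  "R_mat a1 a0 s = mat (s + 1) (s + 1) (\<lambda>(k, l).
     if k = l then 1 else if k = l + 1 then a1 else if k = l + 2 then a0 else 0)"

(* The row vector b * R_s.  Only the coefficients of g up to index s are read, so this is
   meant for polynomials of degree at most s. *)
definition c_vector :: "real \<Rightarrow> real \<Rightarrow> nat \<Rightarrow> real poly \<Rightarrow> real vec" where
  "c_vector a1 a0 s g =
     (let b = vec (s + 1) (\<lambda>i. coeff g i)
      in vec (s + 1) (\<lambda>l. b \<bullet> col (R_mat a1 a0 s) l))"

definition M_mat :: "real \<Rightarrow> real \<Rightarrow> nat \<Rightarrow> real poly mat" where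
  "M_mat a1 a0 s = mat (s + 1) (s + 1) (\<lambda>(k, l).
     if l = s then monom 1 k else [:R_mat a1 a0 s $$ (k, l):])"

definition g_R :: "real \<Rightarrow> real \<Rightarrow> nat \<Rightarrow> real poly" where
  "g_R a1 a0 s = det (M_mat a1 a0 s)"

definition g_M :: "real \<Rightarrow> real \<Rightarrow> nat \<Rightarrow> real poly" where
  "g_M r \<theta> s = (\<Sum>i = 0..s.
     monom (r ^ (s - i) * sin (real (i + 1) * \<theta>) / sin (real (s + 1) * \<theta>)) i)"

end

theory Submission
  imports Defs
begin

text \<open>
  Laplace expansion of \<open>det M\<close> along its last column shows that the coefficients of \<open>g\<^sub>R\<close> are the
  last row of the adjugate of \<open>R\<^sub>s\<close>; as \<open>det R\<^sub>s = 1\<close>, multiplying by \<open>R\<^sub>s\<close> gives the last unit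
  vector. On the other side \<open>a\<^sub>1 = - 2 r cos \<theta>\<close> and \<open>a\<^sub>0 = r\<^sup>2\<close>, so the three-term recurrence for
  \<open>sin (k \<theta>)\<close> cancels all entries of \<open>c\<^sub>M\<close> but the last two: the last one is \<open>1\<close>, and the one before
  is \<open>- r sin ((s + 2) \<theta>) / sin ((s + 1) \<theta>)\<close>, which is nonnegative because \<open>s\<close> is chosen with
  \<open>(s + 1) \<theta> < \<pi> \<le> (s + 2) \<theta>\<close>.
\<close>

lemma R_mat_carrier: "R_mat a1 a0 s \<in> carrier_mat (s + 1) (s + 1)"
  by (simp add: R_mat_def)

lemma R_mat_index:
  assumes "k \<le> s" "l \<le> s"
  shows "R_mat a1 a0 s $$ (k, l) =
    (if k = l then 1 else if k = l + 1 then a1 else if k = l + 2 then a0 else 0)"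
  using assms by (simp add: R_mat_def)

lemma det_R_mat: "det (R_mat a1 a0 s) = 1"
proof -
  have "det (R_mat a1 a0 s) = prod_list (diag_mat (R_mat a1 a0 s))"
    by (rule det_lower_triangular[OF _ R_mat_carrier]) (auto simp: R_mat_index)
  also have "diag_mat (R_mat a1 a0 s) = map (\<lambda>i. 1) [0..<s + 1]"
    by (auto simp: diag_mat_def R_mat_def)
  also have "prod_list \<dots> = 1"
    by (simp add: map_replicate_const prod_list_replicate del: upt_Suc)
  finally show ?thesis .
qed

lemma c_vector_carrier: "c_vector a1 a0 s g \<in> carrier_vec (s + 1)"
  by (simp add: c_vector_def)

lemma c_vector_index_sum:
  assumes "l \<le> s"
  shows "c_vector a1 a0 s g $ l = (\<Sum>k<s + 1. coeff g k * R_mat a1 a0 s $$ (k, l))"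
proof -
  have "dim_row (R_mat a1 a0 s) = s + 1" "dim_col (R_mat a1 a0 s) = s + 1"
    by (simp_all add: R_mat_def)
  then show ?thesis
    using assms
    by (auto simp: c_vector_def scalar_prod_def atLeast0LessThan simp del: sum.lessThan_Suc
        intro!: sum.cong)
qed

text \<open>Column \<open>l\<close> of \<open>R_mat\<close> is supported in rows \<open>l\<close>,
  \<open>l + 1\<close> and \<open>l + 2\<close>; the guards drop the rows that would fall beyond row
  \<open>s\<close>.\<close>

lemma c_vector_index:
  assumes "l \<le> s"
  shows "c_vector a1 a0 s g $ l =
    coeff g l + (if l + 1 \<le> s then a1 * coeff g (l + 1) else 0)
      + (if l + 2 \<le> s then a0 * coeff g (l + 2) else 0)"
proof -
  have "c_vector a1 a0 s g $ l = (\<Sum>k<s + 1. coeff g k * R_mat a1 a0 s $$ (k, l))"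
    by (rule c_vector_index_sum[OF assms])
  also have "\<dots> = (\<Sum>k<s + 1. (if k = l then coeff g k else 0)
      + (if k = l + 1 then a1 * coeff g k else 0) + (if k = l + 2 then a0 * coeff g k else 0))"
    using assms by (intro sum.cong) (auto simp: R_mat_index)
  also have "\<dots> = coeff g l + (if l + 1 \<le> s then a1 * coeff g (l + 1) else 0)
      + (if l + 2 \<le> s then a0 * coeff g (l + 2) else 0)"
    using assms by (simp add: sum.distrib sum.delta less_Suc_eq_le del: sum.lessThan_Suc)
  finally show ?thesis .
qed

text \<open>Embedding scalars as constant polynomials is a ring homomorphism, so it commutes with
  determinants. This serves for the minors of \<open>M_mat\<close> that avoid its last
  column.\<close>

lemma det_const_poly_mat: "det (map_mat (\<lambda>c. [:c:]) A) = [:det (A :: 'a :: comm_ring_1 mat):]"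
proof -
  interpret comm_ring_hom "\<lambda>c :: 'a. [:c:]"
    by unfold_locales (auto simp: one_pCons)
  show ?thesis
    by (rule hom_det)
qed

lemma g_R_conv_cofactor:
  "g_R a1 a0 s = (\<Sum>k<s + 1. monom (cofactor (R_mat a1 a0 s) k s) k)"
proof -
  let ?R = "R_mat a1 a0 s" and ?M = "M_mat a1 a0 s"
  \<comment> \<open>Deleting column \<open>s\<close> removes every power of the indeterminate, and
    what remains is the corresponding minor of \<open>?R\<close> with constant polynomials as
    entries.\<close>
  have cofactor_M: "cofactor ?M k s = [:cofactor ?R k s:]" for k
  proof -
    have "mat_delete ?M k s = map_mat (\<lambda>c. [:c:]) (mat_delete ?R k s)"
      by (rule eq_matI) (auto simp: mat_delete_def M_mat_def R_mat_def)
    moreover have "(- 1) ^ n * [:c:] = [:(- 1) ^ n * c:]" for n and c :: real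
      by (cases "even n") auto
    ultimately show ?thesis
      by (simp add: cofactor_def det_const_poly_mat)
  qed
  have "?M \<in> carrier_mat (s + 1) (s + 1)"
    by (simp add: M_mat_def)
  then have "g_R a1 a0 s = (\<Sum>k<s + 1. ?M $$ (k, s) * cofactor ?M k s)"
    unfolding g_R_def by (rule laplace_expansion_column) simp
  also have "\<dots> = (\<Sum>k<s + 1. monom (cofactor ?R k s) k)"
    unfolding cofactor_M by (intro sum.cong) (auto simp: M_mat_def smult_monom)
  finally show ?thesis .
qed

lemma c_vector_g_R:
  assumes "l \<le> s"
  shows "c_vector a1 a0 s (g_R a1 a0 s) $ l = (if l = s then 1 else 0)"
proof -
  let ?R = "R_mat a1 a0 s"
  have dims: "dim_row ?R = s + 1" "dim_col ?R = s + 1"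
    by (simp_all add: R_mat_def)
  have coeff_g: "coeff (g_R a1 a0 s) k = cofactor ?R k s" if "k \<le> s" for k
    using that by (simp add: g_R_conv_cofactor coeff_sum less_Suc_eq_le del: sum.lessThan_Suc)
  have "c_vector a1 a0 s (g_R a1 a0 s) $ l = (\<Sum>k<s + 1. cofactor ?R k s * ?R $$ (k, l))"
    unfolding c_vector_index_sum[OF assms] by (intro sum.cong) (auto simp: coeff_g)
  \<comment> \<open>The adjugate is the transposed cofactor matrix, so the cofactors along column
    \<open>s\<close> form its row \<open>s\<close>.\<close>
  also have "\<dots> = (adj_mat ?R * ?R) $$ (s, l)"
    using assms dims
    by (auto simp: adj_mat_def times_mat_def scalar_prod_def atLeast0LessThan
        simp del: sum.lessThan_Suc intro!: sum.cong)
  also have "\<dots> = (det ?R \<cdot>\<^sub>m 1\<^sub>m (s + 1)) $$ (s, l)"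
    by (simp only: adj_mat(3)[OF R_mat_carrier])
  also have "\<dots> = (if l = s then 1 else 0)"
    using assms by (simp add: det_R_mat)
  finally show ?thesis .
qed

lemma coeff_g_M:
  assumes "i \<le> s"
  shows "coeff (g_M r \<theta> s) i =
    r ^ (s - i) * sin (real (i + 1) * \<theta>) / sin (real (s + 1) * \<theta>)"
  using assms by (simp add: g_M_def coeff_sum)

lemma sin_three_term: "sin (x + 2 * y) = 2 * cos y * sin (x + y) - sin (x :: real)"
proof -
  have "sin ((x + y) + y) + sin ((x + y) - y) = 2 * cos y * sin (x + y)"
    unfolding sin_add[of "x + y"] sin_diff[of "x + y"] by simp
  moreover have "(x + y) + y = x + 2 * y" "(x + y) - y = x"
    by simp_all
  ultimately show ?thesis
    by simp
qed

text \<open>The imaginary part of the root equation has the nonzero factor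
  \<open>r * sin \<theta>\<close>; cancelling it gives \<open>a1\<close>. With this value the real
  part becomes the Pythagorean identity scaled by \<open>r\<^sup>2\<close>.\<close>

lemma quadratic_coeffs_of_polar_root:
  fixes r \<theta> a0 a1 :: real
  assumes root: "poly (map_poly complex_of_real [:a0, a1, 1:]) (complex_of_real r * exp (\<i> * \<theta>)) = 0"
    and "r > 0" and "sin \<theta> \<noteq> 0"
  shows "a1 = - 2 * r * cos \<theta>" and "a0 = r\<^sup>2"
proof -
  define z where "z = Complex (r * cos \<theta>) (r * sin \<theta>)"
  have "complex_of_real r * exp (\<i> * \<theta>) = z"
    by (simp add: z_def complex_eq_iff Re_exp Im_exp)
  with root have z0: "complex_of_real a0 + z * (complex_of_real a1 + z) = 0"
    by (simp add: map_poly_pCons)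
  have "Im (complex_of_real a0 + z * (complex_of_real a1 + z)) = 0"
    unfolding z0 by simp
  then have "(r * sin \<theta>) * (a1 + 2 * r * cos \<theta>) = 0"
    by (simp add: z_def algebra_simps)
  then show a1: "a1 = - 2 * r * cos \<theta>"
    using assms by simp
  have "Re (complex_of_real a0 + z * (complex_of_real a1 + z)) = 0"
    unfolding z0 by simp
  then have "a0 = (r * cos \<theta>)\<^sup>2 + (r * sin \<theta>)\<^sup>2"
    by (simp add: z_def a1 algebra_simps power2_eq_square)
  then show "a0 = r\<^sup>2"
    by (simp add: power_mult_distrib flip: distrib_left)
qed

lemma c_vector_g_M_last:
  assumes "sin (real (s + 1) * \<theta>) \<noteq> 0"
  shows "c_vector a1 a0 s (g_M r \<theta> s) $ s = 1"
  using assms by (simp add: c_vector_index coeff_g_M)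

lemma c_vector_g_M_inner:
  assumes "l + 2 \<le> s"
  shows "c_vector (- 2 * r * cos \<theta>) (r\<^sup>2) s (g_M r \<theta> s) $ l = 0"
proof -
  \<comment> \<open>Here \<open>m\<close> is the exponent of \<open>r\<close> in coefficient
    \<open>l + 2\<close>. The factors \<open>r\<close> and \<open>r\<^sup>2\<close> in
    \<open>a1\<close> and \<open>a0\<close> raise the three terms to the common power
    \<open>r ^ (m + 2)\<close>, leaving the sine recurrence.\<close>
  obtain m where s: "s = l + 2 + m"
    using assms le_Suc_ex by blast
  define S where "S = sin (real (s + 1) * \<theta>)"
  have "sin (real (l + 3) * \<theta>) =
      2 * cos \<theta> * sin (real (l + 2) * \<theta>) - sin (real (l + 1) * \<theta>)"
    using sin_three_term[of "real (l + 1) * \<theta>" \<theta>] by (simp add: algebra_simps)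
  moreover have "c_vector (- 2 * r * cos \<theta>) (r\<^sup>2) s (g_M r \<theta> s) $ l = r ^ (m + 2) *
      (sin (real (l + 1) * \<theta>) - 2 * cos \<theta> * sin (real (l + 2) * \<theta>) + sin (real (l + 3) * \<theta>)) / S"
  proof -
    have "coeff (g_M r \<theta> s) l = r ^ (m + 2) * sin (real (l + 1) * \<theta>) / S"
      "coeff (g_M r \<theta> s) (l + 1) = r ^ (m + 1) * sin (real (l + 2) * \<theta>) / S"
      "coeff (g_M r \<theta> s) (l + 2) = r ^ m * sin (real (l + 3) * \<theta>) / S"
      using s by (simp_all add: coeff_g_M S_def Suc_diff_le numeral_3_eq_3)
    then show ?thesis
      using assms
      by (simp add: c_vector_index power_add power2_eq_square algebra_simps
          add_divide_distrib diff_divide_distrib)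
  qed
  ultimately show ?thesis
    by simp
qed

text \<open>Row \<open>l + 2\<close> lies outside the matrix, so only two terms of the recurrence
  occur; their sum is minus the missing third one. Writing the degree as \<open>Suc l\<close> avoids
  truncated subtraction.\<close>

lemma c_vector_g_M_penultimate:
  assumes "sin (real (Suc l + 1) * \<theta>) \<noteq> 0"
  shows "c_vector (- 2 * r * cos \<theta>) a0 (Suc l) (g_M r \<theta> (Suc l)) $ l =
    - r * sin (real (Suc l + 2) * \<theta>) / sin (real (Suc l + 1) * \<theta>)"
proof -
  have "sin (real (Suc l + 2) * \<theta>) =
      2 * cos \<theta> * sin (real (Suc l + 1) * \<theta>) - sin (real (l + 1) * \<theta>)"
    using sin_three_term[of "real (l + 1) * \<theta>" \<theta>] by (simp add: algebra_simps)
  moreover have "c_vector (- 2 * r * cos \<theta>) a0 (Suc l) (g_M r \<theta> (Suc l)) $ l =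
      r * sin (real (l + 1) * \<theta>) / sin (real (Suc l + 1) * \<theta>) - 2 * r * cos \<theta>"
    using assms by (simp add: c_vector_index coeff_g_M)
  ultimately show ?thesis
    using assms by (simp only:) (simp add: field_simps)
qed

theorem mainTheorem5:
  fixes a0 a1 r \<theta> :: real and f :: "real poly" and s :: nat
  assumes "f = [:a0, a1, 1:]"
    and "\<nexists>x :: real. poly f x = 0"
    and "r > 0" and "0 < \<theta>" and "\<theta> < pi"
    and "{z :: complex. poly (map_poly complex_of_real f) z = 0} =
      {complex_of_real r * exp (\<i> * complex_of_real \<theta>),
       complex_of_real r * exp (- (\<i> * complex_of_real \<theta>))}"
    and "int s = \<lceil>pi / \<theta>\<rceil> - 2"
  shows "let c\<^sub>R = c_vector a1 a0 s (g_R a1 a0 s);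
             c\<^sub>M = c_vector a1 a0 s (g_M r \<theta> s)
         in c\<^sub>R \<in> carrier_vec (s + 1) \<and> c\<^sub>M \<in> carrier_vec (s + 1) \<and>
            c\<^sub>R \<le> c\<^sub>M \<and>
            (s \<ge> 1 \<longrightarrow> c\<^sub>R $ (s - 1) \<le> c\<^sub>M $ (s - 1)) \<and>
            (\<forall>i \<le> s. i + 1 \<noteq> s \<longrightarrow> c\<^sub>R $ i = c\<^sub>M $ i)"
proof -
  let ?cR = "c_vector a1 a0 s (g_R a1 a0 s)" and ?cM = "c_vector a1 a0 s (g_M r \<theta> s)"
  have "sin \<theta> \<noteq> 0"
    using assms(4,5) sin_gt_zero[of \<theta>] by simp
  moreover have "poly (map_poly complex_of_real [:a0, a1, 1:]) (complex_of_real r * exp (\<i> * \<theta>)) = 0"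
    using assms(1,6) by blast
  ultimately have a1: "a1 = - 2 * r * cos \<theta>" and a0: "a0 = r\<^sup>2"
    using quadratic_coeffs_of_polar_root[OF _ \<open>r > 0\<close>] by blast+
  have "\<lceil>pi / \<theta>\<rceil> = int s + 2"
    using assms(7) by simp
  then have "real s + 1 < pi / \<theta>" and "pi / \<theta> \<le> real s + 2"
    by (simp_all add: ceiling_eq_iff)
  then have below: "real (s + 1) * \<theta> < pi" and above: "pi \<le> real (s + 2) * \<theta>"
    using \<open>0 < \<theta>\<close> by (simp_all add: field_simps)
  have sin_pos: "sin (real (s + 1) * \<theta>) > 0"
    using below \<open>0 < \<theta>\<close> by (intro sin_gt_zero) simp_all
  \<comment> \<open>Adding \<open>\<theta> < pi\<close> to the bound for \<open>s + 1\<close> keeps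
    the angle within one turn, hence in the half turn from \<open>pi\<close> on where the sine is
    nonpositive.\<close>
  have "real (s + 2) * \<theta> < 2 * pi"
    using below \<open>\<theta> < pi\<close> by (simp add: algebra_simps)
  then have sin_nonpos: "sin (real (s + 2) * \<theta>) \<le> 0"
    using above sin_le_zero by blast
  have equal: "?cR $ i = ?cM $ i" if "i \<le> s" "i + 1 \<noteq> s" for i
  proof (cases "i = s")
    case True
    then show ?thesis
      using sin_pos c_vector_g_R[of s s] c_vector_g_M_last[of s \<theta>] by simp
  next
    case False
    \<comment> \<open>Excluding \<open>s\<close> and \<open>s - 1\<close> leaves the indices at
      which both vectors vanish.\<close>
    with that have "i + 2 \<le> s"
      by simp
    then show ?thesis
      using that False by (simp add: a1 a0 c_vector_g_R c_vector_g_M_inner[simplified])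
  qed
  have penultimate: "?cR $ (s - 1) \<le> ?cM $ (s - 1)" if "s \<ge> 1"
  proof -
    \<comment> \<open>At \<open>l = s - 1\<close> the entry of \<open>?cR\<close> is 0, so it
      suffices that the entry of \<open>?cM\<close> is nonnegative.\<close>
    from that obtain l where s: "s = Suc l"
      by (cases s) auto
    have "?cM $ l = - r * sin (real (s + 2) * \<theta>) / sin (real (s + 1) * \<theta>)"
      unfolding a1 s using sin_pos by (intro c_vector_g_M_penultimate) (simp add: s)
    also have "\<dots> \<ge> 0"
      using sin_pos sin_nonpos \<open>r > 0\<close>
      by (intro divide_nonneg_pos) (auto simp: mult_le_0_iff)
    finally show ?thesis
      using c_vector_g_R[of l s] by (simp add: s)
  qed
  have "?cR $ i \<le> ?cM $ i" if "i \<le> s" for i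
    using equal[OF that] penultimate by (cases "i + 1 = s") auto
  then have "?cR \<le> ?cM"
    by (simp add: less_eq_vec_def carrier_vecD[OF c_vector_carrier] less_Suc_eq_le)
  then show ?thesis
    using equal penultimate c_vector_carrier by (simp add: Let_def)
qed

end
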